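(* Let $d$ be a positive integer, let $G=(V,E)$ be a graph and $u,v\in V$. If $\{u,v\}$ is $(d+1)$-linked in $G$, then $\{u,v\}$ is globally $d$-linked in $G$.
   Context: All graphs are finite and simple. A framework in $\mathbb{R}^k$ is a pair $(G,p)$ with $p:V\to\mathbb{R}^k$; it is generic if the coordinates of all $p(v)$ are algebraically independent over $\mathbb{Q}$. The rigidity matrix $R(G,p)$ has a row for each edge $xy$ with $p(x)-p(y)$ in the $k$ columns of $x$, $p(y)-p(x)$ in the $k$ columns of $y$, zeros elsewhere; the $k$-dimensional generic rigidity matroid $\mathcal{R}_k(G)$ is the row matroid of $R(G,p)$ for generic $p$ in $\mathbb{R}^k$, with rank $r_k(G)$. A pair $\{u,v\}$ is $k$-linked in $G$ if $r_k(G+uv)=r_k(G)$. It is globally $d$-linked in $G$ if for every generic framework $(G,p)$ in $\mathbb{R}^d$ and every framework $(G,q)$ in $\mathbb{R}^d$ with $\|p(x)-p(y)\|=\|q(x)-q(y)\|$ for all edges $xy$, we have $\|p(u)-p(v)\|=\|q(u)-q(v)\|$. *)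

theory Defs
  imports "HOL-Analysis.Analysis" "HOL-Analysis.Finite_Function_Topology"
begin

definition simple_graph :: "'v set \<Rightarrow> 'v set set \<Rightarrow> bool" where
  "simple_graph V E \<longleftrightarrow> finite V \<and> (\<forall>e\<in>E. e \<subseteq> V \<and> card e = 2)"

text \<open>
  A point of $k$-space is a map of type \<^typ>\<open>nat \<Rightarrow> real\<close> of which only the coordinates
  \<open>i < k\<close> matter, since the dimensions \<open>d\<close> and \<open>d + 1\<close> have to occur in one statement. A framework
  is accordingly a map \<open>p :: 'v \<Rightarrow> nat \<Rightarrow> real\<close> of which only the values \<open>p x i\<close> with
  \<open>x \<in> V\<close> and \<open>i < k\<close> matter.
\<close>

definition edist :: "nat \<Rightarrow> (nat \<Rightarrow> real) \<Rightarrow> (nat \<Rightarrow> real) \<Rightarrow> real" where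
  "edist k a b = L2_set (\<lambda>i. a i - b i) {..<k}"

text \<open>
  Multivariate polynomials over the rationals in variables of type \<open>'i\<close> are finitely supported maps
  from monomials \<open>'i \<Rightarrow>\<^sub>0 nat\<close> to coefficients.
\<close>

definition rat_mpoly_eval :: "('i \<Rightarrow> real) \<Rightarrow> (('i \<Rightarrow>\<^sub>0 nat) \<Rightarrow>\<^sub>0 rat) \<Rightarrow> real" where
  "rat_mpoly_eval c P =
     (\<Sum>m\<in>Poly_Mapping.keys P. of_rat (Poly_Mapping.lookup P m) *
        (\<Prod>i\<in>Poly_Mapping.keys m. c i ^ Poly_Mapping.lookup m i))"

definition alg_independent_over_rat :: "'i set \<Rightarrow> ('i \<Rightarrow> real) \<Rightarrow> bool" where
  "alg_independent_over_rat I c \<longleftrightarrow>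
     (\<forall>P. (\<forall>m\<in>Poly_Mapping.keys P. Poly_Mapping.keys m \<subseteq> I) \<longrightarrow>
          rat_mpoly_eval c P = 0 \<longrightarrow> P = 0)"

definition generic_framework :: "nat \<Rightarrow> 'v set \<Rightarrow> ('v \<Rightarrow> nat \<Rightarrow> real) \<Rightarrow> bool" where
  "generic_framework k V p \<longleftrightarrow> alg_independent_over_rat (V \<times> {..<k}) (\<lambda>(x, i). p x i)"

text \<open>
  The columns of the rigidity matrix are indexed by pairs (vertex, coordinate), and a row is an
  element of the real vector space \<open>('v \<times> nat) \<Rightarrow>\<^sub>0 real\<close>. The row is symmetric in \<open>x\<close>
  and \<open>y\<close>, so it depends only on the edge \<open>{x, y}\<close>; for \<open>x = y\<close> it is zero.
\<close>

definition rigidity_row :: "nat \<Rightarrow> ('v \<Rightarrow> nat \<Rightarrow> real) \<Rightarrow> 'v \<Rightarrow> 'v \<Rightarrow> ('v \<times> nat) \<Rightarrow>\<^sub>0 real" where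
  "rigidity_row k p x y =
     (\<Sum>i<k. Poly_Mapping.single (x, i) (p x i - p y i) + Poly_Mapping.single (y, i) (p y i - p x i))"

definition rigidity_matrix_rank :: "nat \<Rightarrow> 'v set set \<Rightarrow> ('v \<Rightarrow> nat \<Rightarrow> real) \<Rightarrow> nat" where
  "rigidity_matrix_rank k E p = dim {rigidity_row k p x y | x y. {x, y} \<in> E}"

text \<open>
  Generic frameworks exist because \<open>V\<close> is finite and the reals have infinite transcendence degree
  over the rationals, and the row matroid is the same for all of them, so the choice made here is
  immaterial.
\<close>

definition generic_rigidity_rank :: "nat \<Rightarrow> 'v set \<Rightarrow> 'v set set \<Rightarrow> nat" where
  "generic_rigidity_rank k V E = rigidity_matrix_rank k E (SOME p. generic_framework k V p)"

definition linked :: "nat \<Rightarrow> 'v set \<Rightarrow> 'v set set \<Rightarrow> 'v \<Rightarrow> 'v \<Rightarrow> bool" where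
  "linked k V E u v \<longleftrightarrow>
     generic_rigidity_rank k V (insert {u, v} E) = generic_rigidity_rank k V E"

definition globally_linked :: "nat \<Rightarrow> 'v set \<Rightarrow> 'v set set \<Rightarrow> 'v \<Rightarrow> 'v \<Rightarrow> bool" where
  "globally_linked d V E u v \<longleftrightarrow>
     (\<forall>p q. generic_framework d V p \<longrightarrow>
        (\<forall>x y. {x, y} \<in> E \<longrightarrow> edist d (p x) (p y) = edist d (q x) (q y)) \<longrightarrow>
        edist d (p u) (p v) = edist d (q u) (q v))"

end

theory Submission
  imports Defs "HOL-Computational_Algebra.Polynomial"
begin

text \<open>
  Write \<open>\<Delta>p\<close> for the difference of \<open>p\<close> along an edge. Let \<open>q\<close> have the edge lengths of the
  generic framework \<open>p\<close>. A polynomial relation between the squared edge lengths of \<open>p\<close> holds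
  identically, so the squared edge lengths of \<open>p\<close> can be sent to those of \<open>q + \<epsilon> k\<close>, for
  any \<open>k\<close>, up to first order in \<open>\<epsilon>\<close>. This is a derivation; extended to the coordinates of \<open>p\<close>
  it yields \<open>m\<close> with \<open>\<Delta>p \<bullet> \<Delta>m = \<Delta>q \<bullet> \<Delta>k\<close> on every edge.

  For \<open>k = \<eta> e\<^sub>i\<close> this says that \<open>(m, - q\<^sub>i)\<close> is an infinitesimal motion of the framework \<open>(p, \<eta>)\<close>
  in dimension \<open>d + 1\<close>. If \<open>(p, \<eta>)\<close> is generic, linkedness extends the equation
  \<open>\<Delta>p \<bullet> \<Delta>m = \<Delta>q\<^sub>i \<Delta>\<eta>\<close> to the pair \<open>u, v\<close>. By linearity it can be used with \<open>\<eta> = q\<^sub>i\<close>, a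
  multiple of a difference of two generic \<open>\<eta>\<close>. Summing over \<open>i\<close> gives \<open>M\<close> with
  \<open>\<Delta>p \<bullet> \<Delta>M = \<bar>\<Delta>q\<bar>\<^sup>2\<close> on the edges and on \<open>u, v\<close>. Then \<open>(p - M, 0)\<close> is an infinitesimal motion
  too, whence \<open>\<bar>\<Delta>p\<bar>\<^sup>2 = \<bar>\<Delta>q\<bar>\<^sup>2\<close> on \<open>u, v\<close>.
\<close>

section \<open>Polynomial functions and algebraic independence\<close>

definition monomial_eval :: "('i \<Rightarrow> real) \<Rightarrow> ('i \<Rightarrow>\<^sub>0 nat) \<Rightarrow> real" where
  "monomial_eval c m = (\<Prod>i\<in>Poly_Mapping.keys m. c i ^ Poly_Mapping.lookup m i)"

lemma monomial_eval_superset: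
  assumes "finite S" and "Poly_Mapping.keys m \<subseteq> S"
  shows "monomial_eval c m = (\<Prod>i\<in>S. c i ^ Poly_Mapping.lookup m i)"
  unfolding monomial_eval_def
  by (rule prod.mono_neutral_left) (use assms in \<open>auto simp: in_keys_iff\<close>)

lemma monomial_eval_add: "monomial_eval c (m + m') = monomial_eval c m * monomial_eval c m'"
proof -
  let ?S = "Poly_Mapping.keys m \<union> Poly_Mapping.keys m'"
  have "Poly_Mapping.keys (m + m') \<subseteq> ?S"
    by (rule keys_add)
  then show ?thesis
    by (simp add: monomial_eval_superset[of ?S] lookup_add power_add prod.distrib)
qed

lemma rat_mpoly_eval_superset:
  assumes "finite S" and "Poly_Mapping.keys P \<subseteq> S"
  shows "rat_mpoly_eval c P = (\<Sum>m\<in>S. of_rat (Poly_Mapping.lookup P m) * monomial_eval c m)"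
  unfolding rat_mpoly_eval_def monomial_eval_def
  by (rule sum.mono_neutral_left) (use assms in \<open>auto simp: in_keys_iff\<close>)

lemma rat_mpoly_eval_add: "rat_mpoly_eval c (P + Q) = rat_mpoly_eval c P + rat_mpoly_eval c Q"
proof -
  let ?S = "Poly_Mapping.keys P \<union> Poly_Mapping.keys Q"
  have "Poly_Mapping.keys (P + Q) \<subseteq> ?S"
    by (rule keys_add)
  then show ?thesis
    by (simp add: rat_mpoly_eval_superset[of ?S] lookup_add of_rat_add distrib_right sum.distrib)
qed

lemma rat_mpoly_eval_zero [simp]: "rat_mpoly_eval c 0 = 0"
  by (simp add: rat_mpoly_eval_def)

lemma rat_mpoly_eval_single:
  "rat_mpoly_eval c (Poly_Mapping.single m a) = of_rat a * monomial_eval c m"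
  by (subst rat_mpoly_eval_superset[of "{m}"]) auto

lemma rat_mpoly_eval_sum: "rat_mpoly_eval c (sum P S) = (\<Sum>s\<in>S. rat_mpoly_eval c (P s))"
  by (induction S rule: infinite_finite_induct) (auto simp: rat_mpoly_eval_add)

abbreviation variables_in :: "'i set \<Rightarrow> (('i \<Rightarrow>\<^sub>0 nat) \<Rightarrow>\<^sub>0 rat) \<Rightarrow> bool" where
  "variables_in I P \<equiv> \<forall>m\<in>Poly_Mapping.keys P. Poly_Mapping.keys m \<subseteq> I"

inductive_set function_ring :: "('a \<Rightarrow> real) set \<Rightarrow> ('a \<Rightarrow> real) set" for B where
  one: "(\<lambda>c. 1) \<in> function_ring B"
| base: "F \<in> B \<Longrightarrow> F \<in> function_ring B"
| uminus: "F \<in> function_ring B \<Longrightarrow> (\<lambda>c. - F c) \<in> function_ring B"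
| add: "F \<in> function_ring B \<Longrightarrow> G \<in> function_ring B \<Longrightarrow> (\<lambda>c. F c + G c) \<in> function_ring B"
| mult: "F \<in> function_ring B \<Longrightarrow> G \<in> function_ring B \<Longrightarrow> (\<lambda>c. F c * G c) \<in> function_ring B"

lemma function_ring_diff:
  "F \<in> function_ring B \<Longrightarrow> G \<in> function_ring B \<Longrightarrow> (\<lambda>c. F c - G c) \<in> function_ring B"
  using function_ring.add[OF _ function_ring.uminus, of F B G] by simp

lemma function_ring_zero: "(\<lambda>c. 0) \<in> function_ring B"
  using function_ring_diff[OF function_ring.one function_ring.one] by simp

lemma function_ring_sum:
  "(\<And>s. s \<in> S \<Longrightarrow> F s \<in> function_ring B) \<Longrightarrow> (\<lambda>c. \<Sum>s\<in>S. F s c) \<in> function_ring B"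
  by (induction S rule: infinite_finite_induct)
    (auto simp: function_ring_zero intro: function_ring.add)

lemma function_ring_minimal:
  assumes "B \<subseteq> function_ring B'"
  shows "function_ring B \<subseteq> function_ring B'"
proof
  fix F assume "F \<in> function_ring B"
  then show "F \<in> function_ring B'"
    by induction (use assms in \<open>auto intro: function_ring.intros\<close>)
qed

abbreviation poly_funs :: "'i set \<Rightarrow> (('i \<Rightarrow> real) \<Rightarrow> real) set" where
  "poly_funs I \<equiv> function_ring ((\<lambda>i c. c i) ` I)"

lemma poly_funs_var: "i \<in> I \<Longrightarrow> (\<lambda>c. c i) \<in> poly_funs I"
  by (intro function_ring.base) auto

text \<open>Algebraic independence speaks of formal polynomials; each ring operation on functions is
  matched by one on them.\<close>

lemma poly_funs_rat_mpoly_eval: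
  assumes "F \<in> poly_funs I"
  shows "\<exists>P. variables_in I P \<and> (\<forall>c. F c = rat_mpoly_eval c P)"
  using assms
proof induction
  case one
  show ?case
    by (rule exI[of _ "Poly_Mapping.single 0 1"]) (auto simp: rat_mpoly_eval_single monomial_eval_def simp del: single_one)
next
  case (base F)
  then obtain i where i: "i \<in> I" "F = (\<lambda>c. c i)"
    by blast
  show ?case
    by (rule exI[of _ "Poly_Mapping.single (Poly_Mapping.single i 1) 1"])
      (use i in \<open>auto simp: rat_mpoly_eval_single monomial_eval_def\<close>)
next
  case (uminus F)
  then obtain P where P: "variables_in I P" "\<And>c. F c = rat_mpoly_eval c P"
    by blast
  have "rat_mpoly_eval c (- P) = - rat_mpoly_eval c P" for c
    using rat_mpoly_eval_add[of c P "- P"] by simp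
  moreover have "Poly_Mapping.keys (- P) = Poly_Mapping.keys P"
    by (auto simp: in_keys_iff)
  ultimately show ?case
    using P by (intro exI[of _ "- P"]) auto
next
  case (add F G)
  then obtain P Q where "variables_in I P" "\<And>c. F c = rat_mpoly_eval c P"
    and "variables_in I Q" "\<And>c. G c = rat_mpoly_eval c Q"
    by metis
  moreover from this have "variables_in I (P + Q)"
    using keys_add[of P Q] by (meson UnE subsetD)
  ultimately show ?case
    by (intro exI[of _ "P + Q"]) (simp add: rat_mpoly_eval_add)
next
  case (mult F G)
  then obtain P Q where P: "variables_in I P" "\<And>c. F c = rat_mpoly_eval c P"
    and Q: "variables_in I Q" "\<And>c. G c = rat_mpoly_eval c Q"
    by metis
  \<comment> \<open>The product polynomial as a double sum of single terms, whose values and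
    variables can be read off term by term.\<close>
  define T where "T m m' =
    Poly_Mapping.single (m + m') (Poly_Mapping.lookup P m * Poly_Mapping.lookup Q m')" for m m'
  define R where "R = (\<Sum>m\<in>Poly_Mapping.keys P. \<Sum>m'\<in>Poly_Mapping.keys Q. T m m')"
  have "F c * G c = rat_mpoly_eval c R" for c
    unfolding R_def T_def P Q rat_mpoly_eval_sum rat_mpoly_eval_single monomial_eval_add of_rat_mult
    unfolding rat_mpoly_eval_def monomial_eval_def[symmetric] sum_product
    by (simp add: mult_ac)
  moreover have "variables_in I R"
  proof
    fix n assume "n \<in> Poly_Mapping.keys R"
    then have "Poly_Mapping.lookup R n \<noteq> 0"
      by (simp add: in_keys_iff)
    then have "\<exists>m\<in>Poly_Mapping.keys P. \<exists>m'\<in>Poly_Mapping.keys Q. Poly_Mapping.lookup (T m m') n \<noteq> 0"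
      unfolding R_def lookup_sum by (meson sum.neutral)
    then obtain m m' where mm: "m \<in> Poly_Mapping.keys P" "m' \<in> Poly_Mapping.keys Q"
      and "Poly_Mapping.lookup (T m m') n \<noteq> 0"
      by blast
    then have "n = m + m'"
      by (auto simp: T_def lookup_single when_def split: if_splits)
    then show "Poly_Mapping.keys n \<subseteq> I"
      using keys_add[of m m'] mm P(1) Q(1) by blast
  qed
  ultimately show ?case
    by blast
qed

text \<open>A polynomial vanishing at an independent point is the zero polynomial. In this form
  genericity carries relations from one point to all others.\<close>

lemma poly_funs_eq_zero:
  assumes "alg_independent_over_rat I c" and "F \<in> poly_funs I" and "F c = 0"
  shows "F c' = 0"
proof -
  obtain P where "variables_in I P" "\<And>c. F c = rat_mpoly_eval c P"
    using poly_funs_rat_mpoly_eval[OF assms(2)] by blast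
  moreover from this have "P = 0"
    using assms unfolding alg_independent_over_rat_def by metis
  ultimately show ?thesis
    by simp
qed

section \<open>Existence of algebraically independent points by countability\<close>

lemma countable_poly_mapping_finite_keys:
  assumes "finite I"
  shows "countable {m :: 'a \<Rightarrow>\<^sub>0 'b :: {zero, countable}. Poly_Mapping.keys m \<subseteq> I}"
    (is "countable ?M")
proof (rule countable_image_inj_on)
  show "countable ((\<lambda>m. restrict (Poly_Mapping.lookup m) I) ` ?M)"
    by (rule countable_subset[of _ "PiE I (\<lambda>_. UNIV)"]) (auto intro!: countable_PiE assms)
  show "inj_on (\<lambda>m. restrict (Poly_Mapping.lookup m) I) ?M"
  proof
    fix m m' assume m: "m \<in> ?M" "m' \<in> ?M"
      and eq: "restrict (Poly_Mapping.lookup m) I = restrict (Poly_Mapping.lookup m') I"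
    have "Poly_Mapping.lookup m i = Poly_Mapping.lookup m' i" for i
    proof (cases "i \<in> I")
      case True
      then show ?thesis
        using fun_cong[OF eq, of i] by simp
    next
      case False
      then have "i \<notin> Poly_Mapping.keys m" "i \<notin> Poly_Mapping.keys m'"
        using m by auto
      then show ?thesis
        by (simp add: in_keys_iff)
    qed
    then show "m = m'"
      by (intro poly_mapping_eqI)
  qed
qed

text \<open>There are countably many monomials in \<open>I\<close>, hence countably many finite
  supports, and countably many choices of coefficients on each.\<close>

lemma countable_variables_in:
  assumes "finite I"
  shows "countable {P. variables_in I P}"
proof -
  let ?M = "{m :: 'a \<Rightarrow>\<^sub>0 nat. Poly_Mapping.keys m \<subseteq> I}"
  have "countable {S. finite S \<and> S \<subseteq> ?M}"
    by (rule countable_Collect_finite_subset[OF countable_poly_mapping_finite_keys[OF assms]])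
  then have "countable (\<Union>S\<in>{S. finite S \<and> S \<subseteq> ?M}.
      {P :: _ \<Rightarrow>\<^sub>0 rat. Poly_Mapping.keys P \<subseteq> S})"
    by (rule countable_UN) (auto intro: countable_poly_mapping_finite_keys)
  moreover have "{P. variables_in I P} \<subseteq> (\<Union>S\<in>{S. finite S \<and> S \<subseteq> ?M}.
      {P. Poly_Mapping.keys P \<subseteq> S})"
  proof
    fix P :: "('a \<Rightarrow>\<^sub>0 nat) \<Rightarrow>\<^sub>0 rat" assume "P \<in> {P. variables_in I P}"
    then show "P \<in> (\<Union>S\<in>{S. finite S \<and> S \<subseteq> ?M}. {P. Poly_Mapping.keys P \<subseteq> S})"
      by (intro UN_I[of "Poly_Mapping.keys P"]) auto
  qed
  ultimately show ?thesis
    by (rule countable_subset[rotated])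
qed

text \<open>Each of the countably many nonzero polynomials excludes only the finitely many roots of
  some \<open>f\<close>. Since the reals are uncountable, a good \<open>t\<close> can then be
  chosen.\<close>

lemma countable_not_alg_independent:
  assumes "finite I"
    and "\<And>P. variables_in I P \<Longrightarrow> P \<noteq> 0 \<Longrightarrow>
      \<exists>f :: real poly. f \<noteq> 0 \<and> (\<forall>t. rat_mpoly_eval (c t) P = poly f t)"
  shows "countable {t. \<not> alg_independent_over_rat I (c t)}"
proof -
  have "countable (\<Union>P\<in>{P. variables_in I P} - {0}. {t. rat_mpoly_eval (c t) P = 0})"
  proof (rule countable_UN)
    show "countable ({P. variables_in I P} - {0})"
      by (intro countable_Diff countable_variables_in assms(1))
    fix P assume "P \<in> {P. variables_in I P} - {0}"
    then obtain f :: "real poly" where "f \<noteq> 0" "\<And>t. rat_mpoly_eval (c t) P = poly f t"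
      using assms(2)[of P] by auto
    then show "countable {t. rat_mpoly_eval (c t) P = 0}"
      by (simp add: poly_roots_finite countable_finite)
  qed
  moreover have "{t. \<not> alg_independent_over_rat I (c t)} \<subseteq>
      (\<Union>P\<in>{P. variables_in I P} - {0}. {t. rat_mpoly_eval (c t) P = 0})"
    by (auto simp: alg_independent_over_rat_def)
  ultimately show ?thesis
    by (rule countable_subset[rotated])
qed

lemma rat_mpoly_eval_line:
  "\<exists>f. \<forall>t. rat_mpoly_eval (\<lambda>i. a i + t * b i) P = poly f t"
proof -
  define f where "f = (\<Sum>m\<in>Poly_Mapping.keys P. [:of_rat (Poly_Mapping.lookup P m):] *
        (\<Prod>i\<in>Poly_Mapping.keys m. [:a i, b i:] ^ Poly_Mapping.lookup m i))"
  have "rat_mpoly_eval (\<lambda>i. a i + t * b i) P = poly f t" for t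
    unfolding f_def rat_mpoly_eval_def by (simp add: poly_sum poly_prod)
  then show ?thesis
    by blast
qed

text \<open>The line passes through the independent point \<open>a\<close> at \<open>t = 0\<close>,
  so no nonzero polynomial in these variables vanishes on all of it. The value \<open>0\<close> is
  excluded as well, because the displacement will be divided by \<open>t\<close>.\<close>

lemma alg_independent_line:
  assumes "finite I" and "alg_independent_over_rat I a"
  shows "\<exists>t. t \<noteq> 0 \<and> alg_independent_over_rat I (\<lambda>i. a i + t * b i)"
proof -
  have "countable {t. \<not> alg_independent_over_rat I (\<lambda>i. a i + t * b i)}"
  proof (rule countable_not_alg_independent[OF assms(1)])
    fix P assume P: "variables_in I P" "P \<noteq> 0"
    obtain f where f: "\<And>t. rat_mpoly_eval (\<lambda>i. a i + t * b i) P = poly f t"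
      using rat_mpoly_eval_line by blast
    have "poly f 0 \<noteq> 0"
      using assms(2) P f[of 0] unfolding alg_independent_over_rat_def by auto
    then show "\<exists>f. f \<noteq> 0 \<and> (\<forall>t. rat_mpoly_eval (\<lambda>i. a i + t * b i) P = poly f t)"
      using f by (intro exI[of _ f]) auto
  qed
  then have "countable (insert 0 {t. \<not> alg_independent_over_rat I (\<lambda>i. a i + t * b i)})"
    by simp
  then have "insert 0 {t. \<not> alg_independent_over_rat I (\<lambda>i. a i + t * b i)} \<noteq> UNIV"
    using uncountable_UNIV_real by metis
  then show ?thesis
    by blast
qed

text \<open>Regard \<open>P\<close> as a polynomial in the new variable. Its coefficients are values
  at \<open>c\<close> of rational polynomials in the old variables; one of these is nonzero, and by
  independence so is its value.\<close>

lemma alg_independent_insert: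
  assumes "finite I" and "alg_independent_over_rat I c" and "j \<notin> I"
  shows "\<exists>t. alg_independent_over_rat (insert j I) (c(j := t))"
proof -
  have "countable {t. \<not> alg_independent_over_rat (insert j I) (c(j := t))}"
  proof (rule countable_not_alg_independent)
    show "finite (insert j I)"
      using assms(1) by simp
    fix P assume P: "variables_in (insert j I) P" "P \<noteq> 0"
    define red :: "('a \<Rightarrow>\<^sub>0 nat) \<Rightarrow> _" where "red m = Poly_Mapping.update j 0 m" for m
    have red: "Poly_Mapping.keys (red m) = Poly_Mapping.keys m - {j}" for m
      by (simp add: red_def keys_update)
    have mono: "monomial_eval (c(j := t)) m =
        monomial_eval c (red m) * t ^ Poly_Mapping.lookup m j" for t m
    proof -
      have "monomial_eval (c(j := t)) m =
          (\<Prod>i\<in>insert j (Poly_Mapping.keys m - {j}). (c(j := t)) i ^ Poly_Mapping.lookup m i)"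
        by (rule monomial_eval_superset) auto
      also have "\<dots> = t ^ Poly_Mapping.lookup m j *
          (\<Prod>i\<in>Poly_Mapping.keys m - {j}. c i ^ Poly_Mapping.lookup (red m) i)"
        by (subst prod.insert) (auto simp: red_def lookup_update intro!: prod.cong)
      finally show ?thesis
        unfolding monomial_eval_def[of c "red m"] red by (simp add: mult_ac)
    qed
    define f where "f = (\<Sum>m\<in>Poly_Mapping.keys P.
        monom (of_rat (Poly_Mapping.lookup P m) * monomial_eval c (red m)) (Poly_Mapping.lookup m j))"
    have "rat_mpoly_eval (c(j := t)) P = poly f t" for t
      unfolding f_def poly_sum poly_monom rat_mpoly_eval_def monomial_eval_def[symmetric] mono
      by (simp add: mult_ac)
    moreover have "f \<noteq> 0"
    proof
      assume "f = 0"
      obtain m0 where m0: "m0 \<in> Poly_Mapping.keys P"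
        using P(2) by (metis ex_in_conv keys_eq_empty)
      define n where "n = Poly_Mapping.lookup m0 j"
      define K where "K = {m \<in> Poly_Mapping.keys P. Poly_Mapping.lookup m j = n}"
      \<comment> \<open>The coefficient of the \<open>n\<close>-th power of the variable
        \<open>j\<close> in \<open>P\<close>, as a polynomial in the other variables;
        \<open>red\<close> erases \<open>j\<close> from a monomial.\<close>
      define C where "C = (\<Sum>m\<in>K. Poly_Mapping.single (red m) (Poly_Mapping.lookup P m))"
      have "finite K" and K0: "m0 \<in> K"
        by (auto simp: K_def n_def m0)
      have "rat_mpoly_eval c C = coeff f n"
        unfolding C_def f_def rat_mpoly_eval_sum rat_mpoly_eval_single coeff_sum coeff_monom K_def
        by (subst sum.If_cases) (auto intro!: sum.cong)
      then have "rat_mpoly_eval c C = 0"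
        by (simp add: \<open>f = 0\<close>)
      moreover have "variables_in I C"
      proof
        fix m assume "m \<in> Poly_Mapping.keys C"
        then obtain m' where "m' \<in> K" and "m = red m'"
          unfolding C_def in_keys_iff lookup_sum lookup_single
          by (metis (mono_tags, lifting) sum.neutral when_neq_zero)
        then have "m' \<in> Poly_Mapping.keys P" "m = red m'"
          by (auto simp: K_def)
        then show "Poly_Mapping.keys m \<subseteq> I"
          using P(1) by (auto simp: red)
      qed
      ultimately have "C = 0"
        using assms(2) by (auto simp: alg_independent_over_rat_def)
      \<comment> \<open>All monomials in \<open>K\<close> have the same exponent at
        \<open>j\<close>, so erasing \<open>j\<close> cannot merge another one with
        \<open>m0\<close>, and the coefficient of \<open>red m0\<close> in \<open>C\<close> suffers
        no cancellation.\<close>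
      have inj: "red m = red m0 \<longleftrightarrow> m = m0" if "m \<in> K" for m
      proof
        assume eq: "red m = red m0"
        show "m = m0"
        proof (rule poly_mapping_eqI)
          fix i
          show "Poly_Mapping.lookup m i = Poly_Mapping.lookup m0 i"
          proof (cases "i = j")
            case True
            then show ?thesis
              using that K0 by (simp add: K_def)
          next
            case False
            then show ?thesis
              using arg_cong[OF eq, of "\<lambda>x. Poly_Mapping.lookup x i"]
              by (simp add: red_def lookup_update)
          qed
        qed
      qed auto
      have "Poly_Mapping.lookup C (red m0) = (\<Sum>m\<in>K. if m = m0 then Poly_Mapping.lookup P m else 0)"
        unfolding C_def lookup_sum lookup_single using inj by (intro sum.cong) (auto simp: when_def)
      also have "\<dots> = Poly_Mapping.lookup P m0"
        using \<open>finite K\<close> K0 by simp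
      finally show False
        using \<open>C = 0\<close> m0 by (simp add: in_keys_iff)
    qed
    ultimately show "\<exists>f. f \<noteq> 0 \<and> (\<forall>t. rat_mpoly_eval (c(j := t)) P = poly f t)"
      by blast
  qed
  then have "{t. \<not> alg_independent_over_rat (insert j I) (c(j := t))} \<noteq> UNIV"
    using uncountable_UNIV_real by metis
  then show ?thesis
    by blast
qed

lemma alg_independent_extend:
  assumes "finite J" and "finite I" and "alg_independent_over_rat I c" and "I \<inter> J = {}"
  shows "\<exists>c'. (\<forall>i. i \<notin> J \<longrightarrow> c' i = c i) \<and> alg_independent_over_rat (J \<union> I) c'"
  using assms(1,4)
proof (induction J)
  case empty
  then show ?case
    using assms(3) by auto
next
  case (insert j J)
  then obtain c' where c': "\<forall>i. i \<notin> J \<longrightarrow> c' i = c i" "alg_independent_over_rat (J \<union> I) c'"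
    by auto
  have "\<exists>t. alg_independent_over_rat (insert j (J \<union> I)) (c'(j := t))"
    using insert assms(2) c' by (intro alg_independent_insert) auto
  then obtain t where "alg_independent_over_rat (insert j (J \<union> I)) (c'(j := t))"
    by blast
  then show ?case
    using c'(1) by (intro exI[of _ "c'(j := t)"]) (simp del: fun_upd_apply, simp)
qed

section \<open>Extending derivations of real subrings\<close>

text \<open>A derivation from the subring \<open>A\<close> into the reals: its values may leave
  \<open>A\<close>, and what \<open>D\<close> does outside \<open>A\<close> is left open.\<close>

definition derivation_on :: "real set \<Rightarrow> (real \<Rightarrow> real) \<Rightarrow> bool" where
  "derivation_on A D \<longleftrightarrow> 1 \<in> A \<and> (\<forall>a\<in>A. - a \<in> A) \<and>
     (\<forall>a\<in>A. \<forall>b\<in>A. a + b \<in> A \<and> a * b \<in> A \<and> D (a + b) = D a + D b \<and> D (a * b) = a * D b + b * D a)"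

locale real_derivation =
  fixes A :: "real set" and D :: "real \<Rightarrow> real"
  assumes derivation: "derivation_on A D"
begin

lemma one_closed: "1 \<in> A"
  and uminus_closed: "a \<in> A \<Longrightarrow> - a \<in> A"
  and add_closed: "a \<in> A \<Longrightarrow> b \<in> A \<Longrightarrow> a + b \<in> A"
  and mult_closed: "a \<in> A \<Longrightarrow> b \<in> A \<Longrightarrow> a * b \<in> A"
  and D_add: "a \<in> A \<Longrightarrow> b \<in> A \<Longrightarrow> D (a + b) = D a + D b"
  and D_mult: "a \<in> A \<Longrightarrow> b \<in> A \<Longrightarrow> D (a * b) = a * D b + b * D a"
  using derivation by (auto simp: derivation_on_def)

lemma zero_closed: "0 \<in> A"
  using add_closed[OF one_closed uminus_closed[OF one_closed]] by simp

lemma D_zero [simp]: "D 0 = 0"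
  using D_add[OF zero_closed zero_closed] by simp

lemma D_diff:
  assumes "a \<in> A" "b \<in> A"
  shows "D (a - b) = D a - D b"
  using D_add[OF add_closed[OF assms(1) uminus_closed[OF assms(2)]] assms(2)] by simp

lemma diff_closed: "a \<in> A \<Longrightarrow> b \<in> A \<Longrightarrow> a - b \<in> A"
  using add_closed[OF _ uminus_closed, of a b] by simp

lemma of_nat_closed: "of_nat n \<in> A"
  by (induction n) (auto simp: zero_closed one_closed add_closed)

lemma sum_closed: "(\<And>i. i \<in> I \<Longrightarrow> a i \<in> A) \<Longrightarrow> sum a I \<in> A"
  by (induction I rule: infinite_finite_induct) (auto simp: zero_closed add_closed)

lemma D_sum: "(\<And>i. i \<in> I \<Longrightarrow> a i \<in> A) \<Longrightarrow> D (sum a I) = (\<Sum>i\<in>I. D (a i))"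
  by (induction I rule: infinite_finite_induct) (auto simp: D_add sum_closed)

section \<open>Polynomials over the subring and adjunction of one element\<close>

definition polys :: "real poly set" where
  "polys = {f. \<forall>n. coeff f n \<in> A}"

lemma polys_add: "f \<in> polys \<Longrightarrow> g \<in> polys \<Longrightarrow> f + g \<in> polys"
  by (simp add: polys_def add_closed)

lemma polys_uminus: "f \<in> polys \<Longrightarrow> - f \<in> polys"
  by (simp add: polys_def uminus_closed)

lemma polys_diff: "f \<in> polys \<Longrightarrow> g \<in> polys \<Longrightarrow> f - g \<in> polys"
  by (simp add: polys_def diff_closed)

lemma polys_mult: "f \<in> polys \<Longrightarrow> g \<in> polys \<Longrightarrow> f * g \<in> polys"
  by (simp add: polys_def coeff_mult mult_closed sum_closed)

lemma polys_monom: "a \<in> A \<Longrightarrow> monom a n \<in> polys"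
  by (simp add: polys_def zero_closed)

lemma polys_const: "a \<in> A \<Longrightarrow> [:a:] \<in> polys"
  using polys_monom[of a 0] by (simp add: monom_0)

lemma polys_pderiv:
  assumes "f \<in> polys"
  shows "pderiv f \<in> polys"
proof -
  have "real (Suc n) * coeff f (Suc n) \<in> A" for n
    using assms by (intro mult_closed of_nat_closed) (simp add: polys_def)
  then show ?thesis
    by (simp add: polys_def coeff_pderiv)
qed

lemma map_poly_D_add:
  "f \<in> polys \<Longrightarrow> g \<in> polys \<Longrightarrow> map_poly D (f + g) = map_poly D f + map_poly D g"
  by (rule poly_eqI) (simp add: coeff_map_poly polys_def D_add)

lemma map_poly_D_mult:
  assumes "f \<in> polys" "g \<in> polys"
  shows "map_poly D (f * g) = f * map_poly D g + g * map_poly D f"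
proof (rule poly_eqI)
  fix n
  have "coeff (map_poly D (f * g)) n = (\<Sum>i\<le>n. D (coeff f i * coeff g (n - i)))"
    using assms by (simp add: coeff_map_poly coeff_mult polys_def D_sum mult_closed)
  also have "\<dots> = (\<Sum>i\<le>n. coeff f i * D (coeff g (n - i))) + (\<Sum>i\<le>n. D (coeff f i) * coeff g (n - i))"
    using assms by (simp add: polys_def D_mult sum.distrib mult_ac)
  also have "\<dots> = coeff (f * map_poly D g + map_poly D f * g) n"
    by (simp add: coeff_mult coeff_map_poly)
  finally show "coeff (map_poly D (f * g)) n = coeff (f * map_poly D g + g * map_poly D f) n"
    by (simp add: mult.commute)
qed

text \<open>The value \<open>D (f x)\<close> forced by the rules of differentiation once \<open>D x = \<xi>\<close>.\<close>

definition chain :: "real \<Rightarrow> real \<Rightarrow> real poly \<Rightarrow> real" where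
  "chain x \<xi> f = poly (map_poly D f) x + \<xi> * poly (pderiv f) x"

lemma chain_add:
  "f \<in> polys \<Longrightarrow> g \<in> polys \<Longrightarrow> chain x \<xi> (f + g) = chain x \<xi> f + chain x \<xi> g"
  by (simp add: chain_def map_poly_D_add pderiv_add algebra_simps)

lemma chain_mult:
  "f \<in> polys \<Longrightarrow> g \<in> polys \<Longrightarrow>
   chain x \<xi> (f * g) = poly f x * chain x \<xi> g + poly g x * chain x \<xi> f"
  by (simp add: chain_def map_poly_D_mult pderiv_mult algebra_simps)

lemma chain_const: "chain x \<xi> [:a:] = D a"
  by (simp add: chain_def map_poly_pCons pderiv_pCons)

lemma chain_zero: "chain x \<xi> 0 = 0"
  by (simp add: chain_def)

text \<open>If \<open>x\<close> is transcendental over \<open>A\<close>, every \<xi> will do.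
  Otherwise \<xi> is dictated by an annihilating polynomial \<open>g\<close> of least degree, and
  division by \<open>g\<close> carries the condition to all others.\<close>

lemma exists_consistent_value:
  "\<exists>\<xi>. \<forall>f\<in>polys. poly f x = 0 \<longrightarrow> chain x \<xi> f = 0"
proof (cases "\<exists>f\<in>polys. f \<noteq> 0 \<and> poly f x = 0")
  case False
  then have "chain x 0 f = 0" if "f \<in> polys" "poly f x = 0" for f
    using that chain_zero by auto
  then show ?thesis
    by blast
next
  case True
  define is_ann where "is_ann f \<longleftrightarrow> f \<in> polys \<and> f \<noteq> 0 \<and> poly f x = 0" for f
  from True obtain f0 where "is_ann f0"
    by (auto simp: is_ann_def)
  from ex_has_least_nat[of is_ann, OF this, of degree]
  obtain g where "is_ann g" and min: "\<And>f. is_ann f \<Longrightarrow> degree g \<le> degree f"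
    by auto
  then have g: "g \<in> polys" "g \<noteq> 0" "poly g x = 0"
    by (auto simp: is_ann_def)
  have deg_pos: "0 < degree f" if "f \<noteq> 0" "poly f x = 0" for f
  proof (rule ccontr)
    assume "\<not> 0 < degree f"
    then obtain a where "f = [:a:]"
      using degree_eq_zeroE by blast
    then show False
      using that by simp
  qed
  have "0 < degree g"
    using deg_pos g by blast
  \<comment> \<open>In characteristic zero the derivative is a nonzero polynomial of smaller degree,
    so by minimality it does not annihilate \<open>x\<close>, and the equation for \<xi> can be
    solved.\<close>
  then have "pderiv g \<noteq> 0" and "degree (pderiv g) < degree g"
    by (auto simp: pderiv_eq_0_iff degree_pderiv)
  then have nz: "poly (pderiv g) x \<noteq> 0"
    using min[of "pderiv g"] polys_pderiv[OF g(1)] by (auto simp: is_ann_def)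
  define \<xi> where "\<xi> = - poly (map_poly D g) x / poly (pderiv g) x"
  have chain_g: "chain x \<xi> g = 0"
    using nz by (simp add: chain_def \<xi>_def)
  have "chain x \<xi> f = 0" if "f \<in> polys" "poly f x = 0" for f
    using that
  proof (induction "degree f" arbitrary: f rule: less_induct)
    case less
    show ?case
    proof (cases "f = 0")
      case True
      then show ?thesis
        by (simp add: chain_zero)
    next
      case False
      then have "degree g \<le> degree f" and "0 < degree f"
        using min[of f] deg_pos less.prems by (auto simp: is_ann_def)
      \<comment> \<open>One step of pseudo-division by \<open>g\<close>. As \<open>A\<close> is only
        a ring, \<open>f\<close> is multiplied by the leading coefficient of \<open>g\<close>
        instead of dividing by it.\<close>
      define k where "k = monom (lead_coeff f) (degree f - degree g)"
      define h where "h = [:lead_coeff g:] * f - k * g"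
      have lc: "lead_coeff f \<in> A" "lead_coeff g \<in> A"
        using less.prems g by (auto simp: polys_def)
      then have k: "k \<in> polys" "k * g \<in> polys" and lg: "[:lead_coeff g:] \<in> polys"
        by (auto simp: k_def g intro: polys_monom polys_mult polys_const)
      then have h: "h \<in> polys"
        unfolding h_def by (intro polys_diff polys_mult less.prems(1) g(1))
      have hx: "poly h x = 0"
        using less.prems g by (simp add: h_def)
      have "degree h \<le> degree f"
        unfolding h_def
      proof (rule degree_diff_le)
        show "degree ([:lead_coeff g:] * f) \<le> degree f"
          by (simp add: degree_smult_le)
        have "degree (k * g) \<le> degree k + degree g"
          by (rule degree_mult_le)
        also have "\<dots> \<le> (degree f - degree g) + degree g"
          unfolding k_def by (intro add_mono degree_monom_le) simp
        finally show "degree (k * g) \<le> degree f"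
          using \<open>degree g \<le> degree f\<close> by simp
      qed
      moreover have "coeff h (degree f) = 0"
        using \<open>degree g \<le> degree f\<close> by (simp add: h_def k_def coeff_monom_mult)
      ultimately have "h = 0 \<or> degree h < degree f"
        using eq_zero_or_degree_less by blast
      then have "chain x \<xi> h = 0"
        using less.hyps[of h] h hx chain_zero by auto
      moreover have "[:lead_coeff g:] * f = h + k * g"
        by (simp add: h_def)
      then have "chain x \<xi> ([:lead_coeff g:] * f) = chain x \<xi> h + chain x \<xi> (k * g)"
        using h k by (simp only: chain_add)
      \<comment> \<open>In the product rule the remaining terms carry a factor
        \<open>poly f x\<close>, \<open>poly g x\<close> or \<open>chain x \<xi> g\<close>, all of
        which are zero.\<close>
      ultimately have "lead_coeff g * chain x \<xi> f = 0"
        using less.prems g k lg by (simp add: chain_mult chain_g del: mult_pCons_left)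
      then show ?thesis
        using g by simp
    qed
  qed
  then show ?thesis
    by blast
qed

text \<open>The new ring is \<open>A[x]\<close>, with \<open>D'\<close> given by
  \<open>chain\<close>. Two polynomials with the same value at \<open>x\<close> differ by an
  annihilator of \<open>x\<close>, so the choice of \<xi> makes \<open>D'\<close> well
  defined.\<close>

lemma adjoin:
  "\<exists>A' D'. derivation_on A' D' \<and> A \<subseteq> A' \<and> x \<in> A' \<and> (\<forall>a\<in>A. D' a = D a)"
proof -
  obtain \<xi> where \<xi>: "\<And>f. f \<in> polys \<Longrightarrow> poly f x = 0 \<Longrightarrow> chain x \<xi> f = 0"
    using exists_consistent_value by blast
  define D' where "D' y = chain x \<xi> (SOME f. f \<in> polys \<and> poly f x = y)" for y
  have D': "D' (poly f x) = chain x \<xi> f" if "f \<in> polys" for f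
  proof -
    define g where "g = (SOME g. g \<in> polys \<and> poly g x = poly f x)"
    have g: "g \<in> polys \<and> poly g x = poly f x"
      unfolding g_def by (rule someI[of _ f]) (simp add: that)
    then have "g - f \<in> polys" "poly (g - f) x = 0"
      using that polys_diff by auto
    then have "chain x \<xi> (g - f + f) = chain x \<xi> f"
      using that \<xi> by (subst chain_add) auto
    then show ?thesis
      by (simp add: D'_def g_def)
  qed
  let ?A' = "(\<lambda>f. poly f x) ` polys"
  have const: "poly [:a:] x = a" for a
    by simp
  have "derivation_on ?A' D'"
    unfolding derivation_on_def
  proof (intro conjI ballI)
    show "1 \<in> ?A'"
      using polys_const[OF one_closed] const by (metis imageI)
  next
    fix a assume "a \<in> ?A'"
    then show "- a \<in> ?A'"
      using polys_uminus poly_minus by (metis (mono_tags, lifting) imageE imageI)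
  next
    fix a b assume "a \<in> ?A'" "b \<in> ?A'"
    then obtain f g where fg: "f \<in> polys" "g \<in> polys" and ab: "a = poly f x" "b = poly g x"
      by blast
    have add: "a + b = poly (f + g) x" and mult: "a * b = poly (f * g) x"
      by (simp_all add: ab)
    show "a + b \<in> ?A'" and "a * b \<in> ?A'"
      unfolding add mult by (intro imageI polys_add polys_mult fg)+
    show "D' (a + b) = D' a + D' b" and "D' (a * b) = a * D' b + b * D' a"
      unfolding add mult using fg by (auto simp: ab D' polys_add polys_mult chain_add chain_mult
          simp del: poly_add poly_mult)
  qed
  moreover have "A \<subseteq> ?A'"
    using polys_const const by (metis (no_types, lifting) imageI subsetI)
  moreover have "x \<in> ?A'"
    using polys_monom[OF one_closed, of 1] by (intro image_eqI[of _ _ "monom 1 1"]) (auto simp: poly_monom)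
  moreover have "D' a = D a" if "a \<in> A" for a
    using D'[OF polys_const[OF that]] chain_const by simp
  ultimately show ?thesis
    by blast
qed

end

lemma derivation_extend:
  assumes "finite S" and "derivation_on A D"
  shows "\<exists>A' D'. derivation_on A' D' \<and> A \<subseteq> A' \<and> S \<subseteq> A' \<and> (\<forall>a\<in>A. D' a = D a)"
  using assms(1)
proof induction
  case empty
  then show ?case
    using assms(2) by blast
next
  case (insert x S)
  then obtain A1 D1 where 1: "derivation_on A1 D1" "A \<subseteq> A1" "S \<subseteq> A1" "\<forall>a\<in>A. D1 a = D a"
    by blast
  then interpret real_derivation A1 D1
    by unfold_locales
  obtain A2 D2 where "derivation_on A2 D2" "A1 \<subseteq> A2" "x \<in> A2" "\<forall>a\<in>A1. D2 a = D1 a"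
    using adjoin by blast
  then show ?case
    using 1 by (intro exI[of _ A2] exI[of _ D2]) auto
qed

section \<open>Infinitesimal motions\<close>

text \<open>Gaussian elimination for the unknowns \<open>c e\<close>, with one equation for each
  \<open>j\<close>. All entries stay in the ring, hence vanish at \<open>a\<close> exactly when they
  vanish at \<open>b\<close>, and the same pivots work at both points.\<close>

lemma solvable_transfer:
  fixes M :: "'e \<Rightarrow> 'c \<Rightarrow> 'x \<Rightarrow> real"
  assumes "finite E"
    and zero: "\<And>F. F \<in> function_ring B \<Longrightarrow> F a = 0 \<longleftrightarrow> F b = 0"
    and "\<And>e j. e \<in> E \<Longrightarrow> M e j \<in> function_ring B"
    and "\<And>j. r j \<in> function_ring B"
    and "\<And>j. r j a = (\<Sum>e\<in>E. c e * M e j a)"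
  shows "\<exists>c. \<forall>j. r j b = (\<Sum>e\<in>E. c e * M e j b)"
  using assms(1,3-)
proof (induction E arbitrary: M r)
  case empty
  then show ?case
    using zero by auto
next
  case (insert e0 E)
  show ?case
  proof (cases "\<forall>j. M e0 j a = 0")
    case True
    then have "\<forall>j. M e0 j b = 0"
      using zero insert.prems(1) by blast
    moreover have "\<exists>c. \<forall>j. r j b = (\<Sum>e\<in>E. c e * M e j b)"
      using insert True by (intro insert.IH) auto
    ultimately show ?thesis
      using insert.hyps by auto
  next
    case False
    then obtain j0 where a: "M e0 j0 a \<noteq> 0"
      by blast
    then have b: "M e0 j0 b \<noteq> 0"
      using zero insert.prems(1) by blast
    \<comment> \<open>Equation \<open>j0\<close> eliminates the unknown of \<open>e0\<close>.
      Cross-multiplication avoids division and keeps the entries in the ring.\<close>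
    define M' where "M' e j x = M e0 j0 x * M e j x - M e j0 x * M e0 j x" for e j x
    define r' where "r' j x = M e0 j0 x * r j x - r j0 x * M e0 j x" for j x
    have "\<exists>c. \<forall>j. r' j b = (\<Sum>e\<in>E. c e * M' e j b)"
    proof (rule insert.IH)
      show "M' e j \<in> function_ring B" if "e \<in> E" for e j
        unfolding M'_def using insert.prems(1) that
        by (intro function_ring_diff function_ring.mult) auto
      show "r' j \<in> function_ring B" for j
        unfolding r'_def using insert.prems(1,2)
        by (intro function_ring_diff function_ring.mult) auto
      show "r' j a = (\<Sum>e\<in>E. c e * M' e j a)" for j
        using insert.hyps
        by (simp add: r'_def M'_def insert.prems(3) algebra_simps sum_subtractf sum_distrib_left)
    qed
    then obtain c' where c': "\<And>j. r' j b = (\<Sum>e\<in>E. c' e * M' e j b)"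
      by blast
    \<comment> \<open>Back substitution into the pivot equation \<open>j0\<close>.\<close>
    define c0 where "c0 = (r j0 b - (\<Sum>e\<in>E. c' e * M e j0 b)) / M e0 j0 b"
    have "r j b = (\<Sum>e\<in>insert e0 E. (c'(e0 := c0)) e * M e j b)" for j
    proof -
      let ?m = "M e0 j0 b" and ?s = "\<lambda>j. \<Sum>e\<in>E. c' e * M e j b"
      have "?m * (c0 * M e0 j b + ?s j) = (?m * c0) * M e0 j b + ?m * ?s j"
        by (simp add: algebra_simps)
      also have "?m * c0 = r j0 b - ?s j0"
        using b by (simp add: c0_def)
      also have "?m * ?s j = r' j b + ?s j0 * M e0 j b"
        unfolding c' M'_def by (simp add: algebra_simps sum_subtractf sum_distrib_left)
      also have "(r j0 b - ?s j0) * M e0 j b + (r' j b + ?s j0 * M e0 j b) = ?m * r j b"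
        by (simp add: r'_def algebra_simps)
      finally have "r j b = c0 * M e0 j b + ?s j"
        using b by simp
      also have "\<dots> = (\<Sum>e\<in>insert e0 E. (c'(e0 := c0)) e * M e j b)"
        using insert.hyps by (auto intro!: sum.cong)
      finally show ?thesis .
    qed
    then show ?thesis
      by blast
  qed
qed

lemma span_image_coefficients:
  fixes f :: "'e \<Rightarrow> 'a :: real_vector"
  assumes "finite I" and "x \<in> span (f ` I)"
  shows "\<exists>c. x = (\<Sum>i\<in>I. c i *\<^sub>R f i)"
  using assms
proof (induction I arbitrary: x)
  case (insert i I)
  then obtain k where "x - k *\<^sub>R f i \<in> span (f ` I)"
    by (auto simp: span_breakdown_eq)
  then obtain c where c: "x - k *\<^sub>R f i = (\<Sum>i\<in>I. c i *\<^sub>R f i)"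
    using insert.IH by blast
  have "(\<Sum>l\<in>I. (c(i := k)) l *\<^sub>R f l) = (\<Sum>l\<in>I. c l *\<^sub>R f l)"
    using insert.hyps by (intro sum.cong) auto
  then show ?case
    using insert.hyps c by (intro exI[of _ "c(i := k)"]) (simp add: algebra_simps)
qed simp

text \<open>Otherwise adding \<open>x\<close> to a basis of the span of \<open>S\<close> would raise
  the dimension. This turns equality of ranks into a dependency between rows.\<close>

lemma in_span_if_dim_insert_eq:
  fixes S :: "'a :: real_vector set"
  assumes "finite S" and "dim (insert x S) = dim S"
  shows "x \<in> span S"
proof (rule ccontr)
  assume x: "x \<notin> span S"
  obtain B where B: "B \<subseteq> S" "independent B" "S \<subseteq> span B" "card B = dim S"
    using basis_exists by blast
  have "x \<notin> span B" and "x \<notin> B"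
    using x span_mono[OF B(1)] span_superset[of B] by auto
  then have "independent (insert x B)"
    using B(2) by (simp add: independent_insertI)
  moreover have "insert x S \<subseteq> span (insert x B)"
    using B(3) span_mono[of B "insert x B"] span_superset[of "insert x B"] by auto
  ultimately have "card (insert x B) = dim (insert x S)"
    using B(1) by (intro basis_card_eq_dim) auto
  then show False
    using assms B(1,4) \<open>x \<notin> B\<close> finite_subset by fastforce
qed

section \<open>Rows of the rigidity matrix and infinitesimal motions\<close>

lemma lookup_scaleR: "Poly_Mapping.lookup (c *\<^sub>R x) i = c *\<^sub>R Poly_Mapping.lookup x i"
proof -
  have "finite {i. c *\<^sub>R Poly_Mapping.lookup x i \<noteq> 0}"
    by (rule finite_subset[OF _ finite_keys[of x]]) (auto simp: in_keys_iff)
  then show ?thesis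
    by (simp add: scaleR_poly_mapping_def lookup_Abs_poly_mapping)
qed

lemma lookup_rigidity_row:
  "Poly_Mapping.lookup (rigidity_row k p x y) (z, i) =
     (if i < k then (of_bool (z = x) - of_bool (z = y)) * (p x i - p y i) else 0)"
proof -
  have "Poly_Mapping.lookup (rigidity_row k p x y) (z, i) =
      (\<Sum>j<k. if j = i then (of_bool (z = x) - of_bool (z = y)) * (p x i - p y i) else 0)"
    unfolding rigidity_row_def lookup_sum
    by (intro sum.cong) (auto simp: lookup_add lookup_single when_def)
  then show ?thesis
    by simp
qed

lemma rigidity_row_sym: "rigidity_row k p x y = rigidity_row k p y x"
  by (simp add: rigidity_row_def add.commute)

text \<open>Identifies the kernel of the rigidity matrix with the infinitesimal motions
  \<open>m\<close>.\<close>

lemma rigidity_row_pairing: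
  assumes "finite V" "x \<in> V" "y \<in> V"
  shows "(\<Sum>(z, i)\<in>V \<times> {..<k}. Poly_Mapping.lookup (rigidity_row k p x y) (z, i) * m z i) =
    (\<Sum>i<k. (p x i - p y i) * (m x i - m y i))"
proof -
  have "(\<Sum>(z, i)\<in>V \<times> {..<k}. Poly_Mapping.lookup (rigidity_row k p x y) (z, i) * m z i) =
      (\<Sum>i<k. \<Sum>z\<in>V. of_bool (z = x) * ((p x i - p y i) * m z i) - of_bool (z = y) * ((p x i - p y i) * m z i))"
    unfolding sum.cartesian_product[symmetric]
    by (subst sum.swap) (auto simp: lookup_rigidity_row algebra_simps intro!: sum.cong)
  also have "\<dots> = (\<Sum>i<k. (p x i - p y i) * (m x i - m y i))"
  proof (rule sum.cong)
    fix i
    show "(\<Sum>z\<in>V. of_bool (z = x) * ((p x i - p y i) * m z i) - of_bool (z = y) * ((p x i - p y i) * m z i)) =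
        (p x i - p y i) * (m x i - m y i)"
      using assms by (simp add: sum_subtractf of_bool_def if_distrib[of "\<lambda>c. c * _"] right_diff_distrib cong: if_cong)
  qed simp
  finally show ?thesis .
qed

lemma rigidity_row_poly_fun:
  assumes "x \<in> V" "y \<in> V"
  shows "(\<lambda>c. Poly_Mapping.lookup (rigidity_row k (\<lambda>z i. c (z, i)) x y) j) \<in> poly_funs (V \<times> {..<k})"
proof (cases j)
  case (Pair z i)
  have const: "(\<lambda>c. of_bool b) \<in> poly_funs (V \<times> {..<k})" for b
    using function_ring.one function_ring_zero by (cases b) auto
  show ?thesis
  proof (cases "i < k")
    case True
    then show ?thesis
      unfolding Pair lookup_rigidity_row using assms
      by (auto intro!: function_ring.mult function_ring_diff const poly_funs_var function_ring_zero)
  next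
    case False
    then show ?thesis
      by (simp add: Pair lookup_rigidity_row function_ring_zero)
  qed
qed

text \<open>In the generic framework \<open>p0\<close> that defines the rank, the row of
  \<open>u\<close>, \<open>v\<close> is a combination of edge rows. Solvability of this linear
  system passes to the generic \<open>p\<close>, and the combination found there is paired with
  \<open>m\<close>.\<close>

lemma linked_infinitesimal_motion:
  assumes "simple_graph V E" and "u \<in> V" and "v \<in> V" and "linked k V E u v"
    and "generic_framework k V p"
    and motion: "\<And>x y. {x, y} \<in> E \<Longrightarrow> (\<Sum>i<k. (p x i - p y i) * (m x i - m y i)) = 0"
  shows "(\<Sum>i<k. (p u i - p v i) * (m u i - m v i)) = 0"
proof -
  define p0 where "p0 = (SOME p. generic_framework k V p)"
  have p0: "generic_framework k V p0"
    using assms(5) unfolding p0_def by (rule someI[where P = "generic_framework k V"])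
  \<comment> \<open>Ordered pairs: each edge is listed in both directions, so no orientation has to
    be chosen.\<close>
  define W where "W = {(x, y). {x, y} \<in> E}"
  have W: "x \<in> V \<and> y \<in> V" if "(x, y) \<in> W" for x y
    using assms(1) that by (auto simp: simple_graph_def W_def)
  have "finite V"
    using assms(1) by (simp add: simple_graph_def)
  then have "finite W"
    using W by (intro finite_subset[of W "V \<times> V"]) auto
  define row where "row p e = rigidity_row k p (fst e) (snd e)" for p and e :: "'a \<times> 'a"
  have rows: "{rigidity_row k p0 x y | x y. {x, y} \<in> E} = row p0 ` W"
    by (auto simp: row_def W_def image_iff) blast+
  have rows': "{rigidity_row k p0 x y | x y. {x, y} \<in> insert {u, v} E} =
      insert (row p0 (u, v)) (row p0 ` W)"
    unfolding rows[symmetric] by (auto simp: row_def doubleton_eq_iff rigidity_row_sym)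
  have "row p0 (u, v) \<in> span (row p0 ` W)"
  proof (rule in_span_if_dim_insert_eq)
    show "finite (row p0 ` W)"
      using \<open>finite W\<close> by simp
    show "dim (insert (row p0 (u, v)) (row p0 ` W)) = dim (row p0 ` W)"
      using assms(4) unfolding linked_def generic_rigidity_rank_def rigidity_matrix_rank_def
        p0_def[symmetric] rows rows' .
  qed
  then obtain c0 where c0: "row p0 (u, v) = (\<Sum>e\<in>W. c0 e *\<^sub>R row p0 e)"
    using span_image_coefficients[OF \<open>finite W\<close>] by blast
  define M where "M e j c = Poly_Mapping.lookup (row (\<lambda>z i. c (z, i)) e) j"
    for e :: "'a \<times> 'a" and j and c :: "'a \<times> nat \<Rightarrow> real"
  have M: "M e j (\<lambda>(x, i). P x i) = Poly_Mapping.lookup (row P e) j" for e j P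
    by (simp add: M_def)
  have poly: "M (x, y) j \<in> poly_funs (V \<times> {..<k})" if "x \<in> V" "y \<in> V" for x y j
    unfolding M_def row_def using that by (simp add: rigidity_row_poly_fun)
  have "\<exists>c. \<forall>j. M (u, v) j (\<lambda>(x, i). p x i) = (\<Sum>e\<in>W. c e * M e j (\<lambda>(x, i). p x i))"
  proof (rule solvable_transfer[where B = "(\<lambda>i c. c i) ` (V \<times> {..<k})"
        and a = "\<lambda>(x, i). p0 x i" and M = M and r = "M (u, v)" and c = c0])
    show "finite W"
      by fact
    show "F (\<lambda>(x, i). p0 x i) = 0 \<longleftrightarrow> F (\<lambda>(x, i). p x i) = 0" if "F \<in> poly_funs (V \<times> {..<k})" for F
      using poly_funs_eq_zero[OF _ that] p0 assms(5) unfolding generic_framework_def by blast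
    show "M e j \<in> poly_funs (V \<times> {..<k})" if "e \<in> W" for e j
      using that W by (cases e) (auto intro: poly)
    show "M (u, v) j \<in> poly_funs (V \<times> {..<k})" for j
      using assms by (intro poly)
    show "M (u, v) j (\<lambda>(x, i). p0 x i) = (\<Sum>e\<in>W. c0 e * M e j (\<lambda>(x, i). p0 x i))" for j
      unfolding M c0 lookup_sum by (simp add: lookup_scaleR)
  qed
  then obtain c where c: "\<And>j. Poly_Mapping.lookup (row p (u, v)) j =
      (\<Sum>e\<in>W. c e * Poly_Mapping.lookup (row p e) j)"
    unfolding M by blast
  have "(\<Sum>i<k. (p u i - p v i) * (m u i - m v i)) =
      (\<Sum>(z, i)\<in>V \<times> {..<k}. Poly_Mapping.lookup (row p (u, v)) (z, i) * m z i)"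
    using rigidity_row_pairing[OF \<open>finite V\<close> assms(2,3)] by (simp add: row_def)
  also have "\<dots> = (\<Sum>e\<in>W. c e * (\<Sum>(z, i)\<in>V \<times> {..<k}. Poly_Mapping.lookup (row p e) (z, i) * m z i))"
    unfolding c sum_distrib_left sum_distrib_right
    by (subst sum.swap) (simp add: case_prod_unfold sum_distrib_right mult.assoc)
  also have "\<dots> = 0"
  proof (rule sum.neutral, rule ballI)
    fix e assume "e \<in> W"
    then obtain x y where e: "e = (x, y)" "{x, y} \<in> E"
      by (auto simp: W_def)
    then show "c e * (\<Sum>(z, i)\<in>V \<times> {..<k}. Poly_Mapping.lookup (row p e) (z, i) * m z i) = 0"
      using W[of x y] \<open>e \<in> W\<close> motion rigidity_row_pairing[OF \<open>finite V\<close>, of x y k p m]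
      by (simp add: row_def)
  qed
  finally show ?thesis .
qed

section \<open>Derivations on the ring of squared edge lengths\<close>

lemma poly_fun_line_differentiable:
  assumes "F \<in> poly_funs I"
  shows "(\<lambda>t. F (\<lambda>i. b i + t * h i)) field_differentiable at 0"
  using assms
proof induction
  case (base F)
  then obtain i where "F = (\<lambda>c. c i)"
    by blast
  moreover have "((\<lambda>t. b i + t * h i) has_real_derivative h i) (at 0)"
    by (auto intro!: derivative_eq_intros)
  ultimately show ?case
    by (auto simp: field_differentiable_def)
qed (auto intro: field_differentiable_minus field_differentiable_add field_differentiable_mult)

text \<open>
  Since the values at the independent point \<open>a\<close> determine the functions, differentiation at \<open>b\<close>
  can be carried over to the ring of values at \<open>a\<close>. It satisfies the product rule there
  because the values at \<open>a\<close> and at \<open>b\<close> are the same.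
\<close>

lemma derivation_on_values:
  assumes "alg_independent_over_rat I a" and "B \<subseteq> poly_funs I" and "\<And>F. F \<in> B \<Longrightarrow> F a = F b"
  shows "\<exists>D. derivation_on ((\<lambda>F. F a) ` function_ring B) D \<and>
    (\<forall>F\<in>function_ring B. D (F a) = deriv (\<lambda>t. F (\<lambda>i. b i + t * h i)) 0)"
proof -
  let ?R = "function_ring B"
  let ?d = "\<lambda>F. deriv (\<lambda>t. F (\<lambda>i. b i + t * h i)) 0"
  have sub: "?R \<subseteq> poly_funs I"
    by (rule function_ring_minimal) fact
  have ab: "F a = F b" if "F \<in> ?R" for F
    using that by induction (auto simp: assms(3))
  have inj: "inj_on (\<lambda>F. F a) ?R"
  proof
    fix F G assume "F \<in> ?R" "G \<in> ?R" "F a = G a"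
    then have "(\<lambda>c. F c - G c) \<in> poly_funs I" and "F a - G a = 0"
      using subsetD[OF sub function_ring_diff] by auto
    then have "F c - G c = 0" for c
      using poly_funs_eq_zero[OF assms(1)] by blast
    then show "F = G"
      by auto
  qed
  define D where "D y = ?d (inv_into ?R (\<lambda>F. F a) y)" for y
  have D: "D (F a) = ?d F" if "F \<in> ?R" for F
    using inv_into_f_f[OF inj that] by (simp add: D_def)
  \<comment> \<open>\<open>deriv\<close> is total, and its sum and product rules need
    differentiability.\<close>
  have diff: "(\<lambda>t. F (\<lambda>i. b i + t * h i)) field_differentiable at 0" if "F \<in> ?R" for F
    using that sub poly_fun_line_differentiable by blast
  have "derivation_on ((\<lambda>F. F a) ` ?R) D"
    unfolding derivation_on_def
  proof (intro conjI ballI)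
    show "1 \<in> (\<lambda>F. F a) ` ?R"
      using imageI[OF function_ring.one, of "\<lambda>F. F a"] by simp
  next
    fix x assume "x \<in> (\<lambda>F. F a) ` ?R"
    then obtain F where "F \<in> ?R" "x = F a"
      by blast
    then show "- x \<in> (\<lambda>F. F a) ` ?R"
      using imageI[OF function_ring.uminus, of F B "\<lambda>F. F a"] by simp
  next
    fix x y assume "x \<in> (\<lambda>F. F a) ` ?R" "y \<in> (\<lambda>F. F a) ` ?R"
    then obtain F G where F: "F \<in> ?R" "x = F a" and G: "G \<in> ?R" "y = G a"
      by blast
    show "x + y \<in> (\<lambda>F. F a) ` ?R"
      using imageI[OF function_ring.add, of F B G "\<lambda>F. F a"] F G by simp
    show "x * y \<in> (\<lambda>F. F a) ` ?R"
      using imageI[OF function_ring.mult, of F B G "\<lambda>F. F a"] F G by simp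
    show "D (x + y) = D x + D y"
      using D[OF function_ring.add[OF F(1) G(1)]] diff F G by (simp add: D)
    have mult: "D (x * y) = F b * ?d G + G b * ?d F"
      using D[OF function_ring.mult[OF F(1) G(1)]] diff F G by simp
    have Dxy: "D x = ?d F" "D y = ?d G"
      using D F G by auto
    have "x = F b" "y = G b"
      using F G ab by auto
    then show "D (x * y) = x * D y + y * D x"
      unfolding mult Dxy by simp
  qed
  then show ?thesis
    using D by blast
qed

text \<open>Differentiation at \<open>q\<close> in direction \<open>k\<close> induces a derivation
  on the ring generated by the squared edge lengths of \<open>p\<close>. It is extended to the
  coordinates of \<open>p\<close>, and its values there form \<open>m\<close>.\<close>

lemma exists_lifted_motion:
  assumes "simple_graph V E" and "generic_framework d V p"
    and "\<And>x y. {x, y} \<in> E \<Longrightarrow> (\<Sum>i<d. (p x i - p y i)\<^sup>2) = (\<Sum>i<d. (q x i - q y i)\<^sup>2)"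
  shows "\<exists>m. \<forall>x y. {x, y} \<in> E \<longrightarrow>
    (\<Sum>i<d. (p x i - p y i) * (m x i - m y i)) = (\<Sum>i<d. (q x i - q y i) * (k x i - k y i))"
proof -
  define a where "a = (\<lambda>(x, i). p x i)"
  define len where "len x y c = (\<Sum>i<d. (c (x, i) - c (y, i)) * (c (x, i) - c (y, i)))"
    for x y :: 'a and c :: "'a \<times> nat \<Rightarrow> real"
  define B where "B = {len x y | x y. {x, y} \<in> E}"
  have V: "x \<in> V" "y \<in> V" if "{x, y} \<in> E" for x y
    using assms(1) that by (auto simp: simple_graph_def)
  have "\<exists>D. derivation_on ((\<lambda>F. F a) ` function_ring B) D \<and>
    (\<forall>F\<in>function_ring B. D (F a) = deriv (\<lambda>t. F (\<lambda>i. (\<lambda>(x, i). q x i) i + t * (\<lambda>(x, i). k x i) i)) 0)"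
  proof (rule derivation_on_values)
    show "alg_independent_over_rat (V \<times> {..<d}) a"
      using assms(2) by (simp add: generic_framework_def a_def)
    show "B \<subseteq> poly_funs (V \<times> {..<d})"
      unfolding B_def len_def
      by (auto dest: V intro!: function_ring_sum function_ring.mult function_ring_diff poly_funs_var)
    show "F a = F (\<lambda>(x, i). q x i)" if "F \<in> B" for F
      using that assms(3) by (auto simp: B_def len_def a_def power2_eq_square)
  qed
  then obtain D where D: "derivation_on ((\<lambda>F. F a) ` function_ring B) D"
    and D_len: "\<And>F. F \<in> function_ring B \<Longrightarrow>
      D (F a) = deriv (\<lambda>t. F (\<lambda>i. (\<lambda>(x, i). q x i) i + t * (\<lambda>(x, i). k x i) i)) 0"
    by blast
  have "finite (a ` (V \<times> {..<d}))"
    using assms(1) by (simp add: simple_graph_def)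
  from derivation_extend[OF this D] obtain A' D'
    where ext: "derivation_on A' D' \<and> (\<lambda>F. F a) ` function_ring B \<subseteq> A' \<and>
      a ` (V \<times> {..<d}) \<subseteq> A' \<and> (\<forall>x\<in>(\<lambda>F. F a) ` function_ring B. D' x = D x)"
    by (elim exE)
  have D': "derivation_on A' D'" and A': "a ` (V \<times> {..<d}) \<subseteq> A'"
    using ext by simp_all
  have eq: "D' (F a) = D (F a)" if "F \<in> function_ring B" for F
    using ext that by simp
  interpret real_derivation A' D'
    by unfold_locales fact
  have "(\<Sum>i<d. (p x i - p y i) * (D' (p x i) - D' (p y i))) = (\<Sum>i<d. (q x i - q y i) * (k x i - k y i))"
    if xy: "{x, y} \<in> E" for x y
  proof -
    have mem: "p x i \<in> A'" "p y i \<in> A'" if "i < d" for i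
      using A' V[OF xy] that by (auto simp: a_def image_subset_iff)
    have "len x y \<in> function_ring B"
      using xy by (auto simp: B_def intro!: function_ring.base)
    then have "D' (len x y a) = deriv (\<lambda>t. len x y (\<lambda>i. (\<lambda>(x, i). q x i) i + t * (\<lambda>(x, i). k x i) i)) 0"
      using eq D_len by auto
    also have "\<dots> = 2 * (\<Sum>i<d. (q x i - q y i) * (k x i - k y i))"
      unfolding len_def prod.case
      by (rule DERIV_imp_deriv)
        (auto intro!: derivative_eq_intros simp: sum_distrib_left algebra_simps)
    \<comment> \<open>The same value computed by the rules for \<open>D'\<close> from the
      coordinates of \<open>p\<close>; the factor 2 then cancels.\<close>
    also have "D' (len x y a) = (\<Sum>i<d. D' ((p x i - p y i) * (p x i - p y i)))"
      unfolding len_def a_def prod.case using mem by (intro D_sum mult_closed diff_closed) auto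
    also have "\<dots> = (\<Sum>i<d. 2 * ((p x i - p y i) * (D' (p x i) - D' (p y i))))"
      using mem by (intro sum.cong) (auto simp: D_mult D_diff diff_closed)
    finally show ?thesis
      by (simp add: sum_distrib_left[symmetric])
  qed
  then show ?thesis
    by (intro exI[of _ "\<lambda>x i. D' (p x i)"]) blast
qed

section \<open>Generic frameworks one dimension higher and the theorem\<close>

lemma edist_eq_iff:
  "edist d a b = edist d a' b' \<longleftrightarrow> (\<Sum>i<d. (a i - b i)\<^sup>2) = (\<Sum>i<d. (a' i - b' i)\<^sup>2)"
  by (simp add: edist_def L2_set_def)

text \<open>Independent values are adjoined for the new coordinate, which has index \<open>d\<close>
  because coordinates are counted from \<open>0\<close>.\<close>

lemma generic_framework_extend:
  assumes "finite V" and "generic_framework d V p"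
  shows "\<exists>P. generic_framework (Suc d) V P \<and> (\<forall>x. \<forall>i<d. P x i = p x i)"
proof -
  have "\<exists>c. (\<forall>j. j \<notin> V \<times> {d} \<longrightarrow> c j = (\<lambda>(x, i). p x i) j) \<and>
      alg_independent_over_rat (V \<times> {d} \<union> V \<times> {..<d}) c"
    using assms by (intro alg_independent_extend) (auto simp: generic_framework_def)
  then obtain c where c: "\<And>j. j \<notin> V \<times> {d} \<Longrightarrow> c j = (\<lambda>(x, i). p x i) j"
    and indep: "alg_independent_over_rat (V \<times> {d} \<union> V \<times> {..<d}) c"
    by blast
  have "V \<times> {d} \<union> V \<times> {..<d} = V \<times> {..<Suc d}"
    by auto
  then have "generic_framework (Suc d) V (\<lambda>x i. c (x, i))"
    using indep by (simp add: generic_framework_def)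
  then show ?thesis
    using c by (intro exI[of _ "\<lambda>x i. c (x, i)"]) auto
qed

lemma generic_framework_line:
  assumes "finite V" and "generic_framework k V p"
  shows "\<exists>t. t \<noteq> 0 \<and> generic_framework k V (\<lambda>x i. p x i + t * b x i)"
proof -
  have "\<exists>t. t \<noteq> 0 \<and> alg_independent_over_rat (V \<times> {..<k})
      (\<lambda>j. (\<lambda>(x, i). p x i) j + t * (\<lambda>(x, i). b x i) j)"
    using assms by (intro alg_independent_line) (auto simp: generic_framework_def)
  then show ?thesis
    by (simp add: generic_framework_def case_prod_unfold)
qed

theorem theorem1p6:
  fixes d :: nat and V :: "'v set" and E :: "'v set set" and u v :: 'v
  assumes "d \<ge> 1"
    and "simple_graph V E"
    and "u \<in> V" and "v \<in> V"
    and "linked (d + 1) V E u v"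
  shows "globally_linked d V E u v"
  unfolding globally_linked_def
proof (intro allI impI)
  fix p q :: "'v \<Rightarrow> nat \<Rightarrow> real"
  assume p: "generic_framework d V p"
    and "\<forall>x y. {x, y} \<in> E \<longrightarrow> edist d (p x) (p y) = edist d (q x) (q y)"
  then have eq: "(\<Sum>i<d. (p x i - p y i)\<^sup>2) = (\<Sum>i<d. (q x i - q y i)\<^sup>2)" if "{x, y} \<in> E" for x y
    using that by (simp add: edist_eq_iff)
  have "finite V"
    using assms(2) by (simp add: simple_graph_def)
  let ?good = "\<lambda>x y. {x, y} \<in> insert {u, v} E"
  note linked = linked_infinitesimal_motion[OF assms(2-4) assms(5)[unfolded Suc_eq_plus1[symmetric]]]

  \<comment> \<open>The last coordinate of \<open>P\<close> serves as the generic \<eta>. The lift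
    along \<eta> in coordinate \<open>l\<close> gives the equation on edges, and linkedness adds the
    pair \<open>u\<close>, \<open>v\<close>.\<close>
  have generic: "\<exists>m. \<forall>x y. ?good x y \<longrightarrow>
      (\<Sum>i<d. (p x i - p y i) * (m x i - m y i)) = (q x l - q y l) * (P x d - P y d)"
    if "l < d" "generic_framework (Suc d) V P" "\<And>x i. i < d \<Longrightarrow> P x i = p x i" for l P
  proof -
    obtain m where "\<And>x y. {x, y} \<in> E \<Longrightarrow> (\<Sum>i<d. (p x i - p y i) * (m x i - m y i)) =
        (\<Sum>i<d. (q x i - q y i) * ((if i = l then P x d else 0) - (if i = l then P y d else 0)))"
      using exists_lifted_motion[OF assms(2) p eq, of "\<lambda>x i. if i = l then P x d else 0"] by blast
    moreover have "(\<Sum>i<d. (q x i - q y i) * ((if i = l then P x d else 0) - (if i = l then P y d else 0))) =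
        (q x l - q y l) * (P x d - P y d)" for x y
      using \<open>l < d\<close> by (subst sum.remove[of _ l]) auto
    ultimately have m: "(\<Sum>i<d. (p x i - p y i) * (m x i - m y i)) =
        (q x l - q y l) * (P x d - P y d)" if "{x, y} \<in> E" for x y
      using that by simp
    \<comment> \<open>The motion \<open>(m, - q_l)\<close> of \<open>P\<close>; its last coordinate
      supplies the subtracted product.\<close>
    define n where "n x i = (if i = d then - q x l else m x i)" for x i
    have n: "(\<Sum>i<Suc d. (P x i - P y i) * (n x i - n y i)) =
        (\<Sum>i<d. (p x i - p y i) * (m x i - m y i)) - (q x l - q y l) * (P x d - P y d)" for x y
      using that(3) by (simp add: n_def algebra_simps)
    have "(\<Sum>i<Suc d. (P u i - P v i) * (n u i - n v i)) = 0"
      using linked[OF that(2), of n] m unfolding n by simp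
    then have uv: "(\<Sum>i<d. (p u i - p v i) * (m u i - m v i)) = (q u l - q v l) * (P u d - P v d)"
      unfolding n by simp
    \<comment> \<open>The set \<open>{u, v}\<close> also matches with \<open>x = v\<close> and
      \<open>y = u\<close>.\<close>
    moreover have "(\<Sum>i<d. (p v i - p u i) * (m v i - m u i)) =
        (\<Sum>i<d. (p u i - p v i) * (m u i - m v i))"
      by (intro sum.cong) (auto simp: algebra_simps)
    ultimately show ?thesis
      using m by (intro exI[of _ m]) (auto simp: doubleton_eq_iff algebra_simps)
  qed

  obtain P where P: "generic_framework (Suc d) V P" "\<And>x i. i < d \<Longrightarrow> P x i = p x i"
    using generic_framework_extend[OF \<open>finite V\<close> p] by blast
  define lifts where "lifts l m \<longleftrightarrow> (\<forall>x y. ?good x y \<longrightarrow>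
      (\<Sum>i<d. (p x i - p y i) * (m x i - m y i)) = (q x l - q y l)\<^sup>2)" for l m
  have "\<exists>m. lifts l m" if l: "l < d" for l
  proof -
    \<comment> \<open>Coordinate \<open>l\<close> of \<open>q\<close> need not be generic as a last
      coordinate, but adding a suitable nonzero multiple of it to that of \<open>P\<close> keeps
      \<open>P\<close> generic. The difference of the two lifts, divided by \<open>t\<close>, is the
      lift wanted.\<close>
    obtain t where "t \<noteq> 0"
      and t: "generic_framework (Suc d) V (\<lambda>x i. P x i + t * (if i = d then q x l else 0))"
      using generic_framework_line[OF \<open>finite V\<close> P(1), of "\<lambda>x i. if i = d then q x l else 0"] by blast
    obtain m0 where m0: "\<And>x y. ?good x y \<Longrightarrow> (\<Sum>i<d. (p x i - p y i) * (m0 x i - m0 y i)) =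
        (q x l - q y l) * (P x d - P y d)"
      using generic[OF l P] by blast
    have "\<exists>m. \<forall>x y. ?good x y \<longrightarrow> (\<Sum>i<d. (p x i - p y i) * (m x i - m y i)) =
        (q x l - q y l) * ((P x d + t * q x l) - (P y d + t * q y l))"
      using generic[OF l t] P(2) by simp
    then obtain m1 where m1: "\<And>x y. ?good x y \<Longrightarrow> (\<Sum>i<d. (p x i - p y i) * (m1 x i - m1 y i)) =
        (q x l - q y l) * ((P x d + t * q x l) - (P y d + t * q y l))"
      by blast
    define m where "m x i = (m1 x i - m0 x i) / t" for x i
    have "(\<Sum>i<d. (p x i - p y i) * (m x i - m y i)) = (q x l - q y l)\<^sup>2" if "?good x y" for x y
    proof -
      have "(\<Sum>i<d. (p x i - p y i) * (m x i - m y i)) =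
          (\<Sum>i<d. ((p x i - p y i) * (m1 x i - m1 y i) - (p x i - p y i) * (m0 x i - m0 y i)) / t)"
        using \<open>t \<noteq> 0\<close> by (intro sum.cong) (auto simp: m_def field_simps)
      also have "\<dots> = ((q x l - q y l) * (t * (q x l - q y l))) / t"
        unfolding sum_divide_distrib[symmetric] sum_subtractf m0[OF that] m1[OF that]
        by (simp add: algebra_simps)
      finally show ?thesis
        using \<open>t \<noteq> 0\<close> by (simp add: power2_eq_square)
    qed
    then have "lifts l m"
      by (simp add: lifts_def)
    then show ?thesis
      by blast
  qed
  then obtain m where lifts: "\<And>l. l < d \<Longrightarrow> lifts l (m l)"
    by metis
  have m: "(\<Sum>i<d. (p x i - p y i) * (m l x i - m l y i)) = (q x l - q y l)\<^sup>2"
    if "l < d" "?good x y" for l x y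
    using lifts[OF that(1)] that(2) unfolding lifts_def by blast
  \<comment> \<open>The motion \<open>(p - M, 0)\<close>, where \<open>M\<close> is the sum of the
    lifts \<open>m l\<close>. Its last coordinate is zero, so only the first \<open>d\<close>
    coordinates contribute to the pairing.\<close>
  define n where "n x i = (if i = d then 0 else p x i - (\<Sum>l<d. m l x i))" for x i
  have n: "(\<Sum>i<Suc d. (P x i - P y i) * (n x i - n y i)) =
      (\<Sum>i<d. (p x i - p y i)\<^sup>2) - (\<Sum>i<d. (q x i - q y i)\<^sup>2)" if "?good x y" for x y
  proof -
    have "(\<Sum>i<Suc d. (P x i - P y i) * (n x i - n y i)) =
        (\<Sum>i<d. (p x i - p y i)\<^sup>2 - (\<Sum>l<d. (p x i - p y i) * (m l x i - m l y i)))"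
    proof -
      have "(p x i - p y i) * (n x i - n y i) =
          (p x i - p y i)\<^sup>2 - (\<Sum>l<d. (p x i - p y i) * (m l x i - m l y i))" if "i < d" for i
      proof -
        have "n x i - n y i = (p x i - p y i) - (\<Sum>l<d. m l x i - m l y i)"
          using that by (simp add: n_def sum_subtractf)
        then show ?thesis
          by (simp add: power2_eq_square right_diff_distrib[of "p x i - p y i"] sum_distrib_left)
      qed
      then show ?thesis
        using P(2) by (simp add: n_def)
    qed
    also have "\<dots> = (\<Sum>i<d. (p x i - p y i)\<^sup>2) -
        (\<Sum>l<d. \<Sum>i<d. (p x i - p y i) * (m l x i - m l y i))"
      by (simp add: sum_subtractf) (rule sum.swap)
    finally show ?thesis
      using m that by simp
  qed
  \<comment> \<open>On edges the difference of squared lengths is zero, so \<open>n\<close> is an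
    infinitesimal motion of \<open>P\<close>; linkedness yields the same at \<open>u\<close>,
    \<open>v\<close>, where the pairing is again that difference.\<close>
  have "(\<Sum>i<Suc d. (P u i - P v i) * (n u i - n v i)) = 0"
    using n eq by (intro linked P(1)) auto
  then show "edist d (p u) (p v) = edist d (q u) (q v)"
    using n[of u v] by (simp add: edist_eq_iff)
qed

end
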